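(* Let $m,n\ge 0$ be integers and let $B_{m,n}$ be the weighted tree with vertices $E_0,E_1,\dots,E_m,F_1,\dots,F_n$, where $E_0$ has weight $3$, all other vertices have weight $2$, and the edges are those of the chain $E_m - E_{m-1} - \cdots - E_1 - E_0 - F_2 - F_3 - \cdots - F_n$ together with one edge joining $F_1$ and $F_2$. Then the number of elements (roots) of the triple root system $R(B_{m,n})$ is $$n(n+1)(m+1)+m(m+1)+n(n+1).$$
   Context: For a finite weighted tree $\Gamma$ with vertices $V_i$ of weights $w_i$, the intersection form on $\bigoplus_i\mathbb{Z}V_i$ is the symmetric bilinear form with $(V_i\cdot V_i)=-w_i$ and, for $i\neq j$, $(V_i\cdot V_j)=1$ if $V_i$ and $V_j$ are joined by an edge and $0$ otherwise. A non-zero element $\sum m_iV_i$ is a positive (resp. negative) divisor if all $m_i\ge 0$ (resp. all $m_i\le 0$). The triple root system $R(\Gamma)$ is the set of all positive and negative divisors $Y$ with $(Y\cdot Y)=-2$ or $(Y\cdot Y)=-3$; its elements are called roots. The trees $B_{m,n}$ form one of the families in Artin's classification of rational $3$-tuple trees, i.e. the dual graphs of the minimal resolutions of rational surface singularities of multiplicity $3$.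
   Formalization: The formal theorem assumes n ≥ 1 instead of n ≥ 0: for n = 0 only the chain E_m − ⋯ − E_0 remains, which has (m+1)(m+2) roots rather than the m(m+1) given by the formula (e.g. m = n = 0 has the two roots ±E_0). *)

theory Defs
  imports "HOL-Library.Poly_Mapping"
begin

record 'v weighted_graph =
  vertices :: "'v set"
  edges :: "'v set set"
  weight :: "'v \<Rightarrow> int"

text \<open>
  The free abelian group on the vertices is represented by the finitely supported functions
  \<^typ>\<open>'v \<Rightarrow>\<^sub>0 int\<close> whose support consists of vertices.
\<close>

definition divisors :: "'v weighted_graph \<Rightarrow> ('v \<Rightarrow>\<^sub>0 int) set" where
  "divisors G = {Y. Poly_Mapping.keys Y \<subseteq> vertices G}"

definition vertex_intersection :: "'v weighted_graph \<Rightarrow> 'v \<Rightarrow> 'v \<Rightarrow> int" where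
  "vertex_intersection G u v =
     (if u = v then - weight G u else if {u, v} \<in> edges G then 1 else 0)"

definition intersection_form ::
    "'v weighted_graph \<Rightarrow> ('v \<Rightarrow>\<^sub>0 int) \<Rightarrow> ('v \<Rightarrow>\<^sub>0 int) \<Rightarrow> int" where
  "intersection_form G X Y =
     (\<Sum>u\<in>vertices G. \<Sum>v\<in>vertices G.
        Poly_Mapping.lookup X u * Poly_Mapping.lookup Y v * vertex_intersection G u v)"

definition positive_divisor :: "'v weighted_graph \<Rightarrow> ('v \<Rightarrow>\<^sub>0 int) \<Rightarrow> bool" where
  "positive_divisor G Y \<longleftrightarrow>
     Y \<in> divisors G \<and> Y \<noteq> 0 \<and> (\<forall>v\<in>vertices G. Poly_Mapping.lookup Y v \<ge> 0)"

definition negative_divisor :: "'v weighted_graph \<Rightarrow> ('v \<Rightarrow>\<^sub>0 int) \<Rightarrow> bool" where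
  "negative_divisor G Y \<longleftrightarrow>
     Y \<in> divisors G \<and> Y \<noteq> 0 \<and> (\<forall>v\<in>vertices G. Poly_Mapping.lookup Y v \<le> 0)"

definition triple_root_system :: "'v weighted_graph \<Rightarrow> ('v \<Rightarrow>\<^sub>0 int) set" where
  "triple_root_system G =
     {Y. (positive_divisor G Y \<or> negative_divisor G Y) \<and>
         (intersection_form G Y Y = -2 \<or> intersection_form G Y Y = -3)}"

datatype B_vertex = E nat | F nat

text \<open>
  The chain \<open>E m - \<dots> - E 1 - E 0 - F 2 - F 3 - \<dots> - F n\<close> together with the edge
  \<open>F 1 - F 2\<close>. An edge is present only if both of its endpoints are vertices, so for
  \<open>n = 1\<close> the vertex \<open>F 1\<close> is isolated, and for \<open>n = 0\<close> only the chain of the \<open>E i\<close> is left. In the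
  latter case there are \<open>(m + 1) * (m + 2)\<close> roots, which differs from the value \<open>m * (m + 1)\<close>
  of the counting formula at \<open>n = 0\<close>; the formula holds only for \<open>n \<ge> 1\<close>.
\<close>

definition B_edges :: "nat \<Rightarrow> nat \<Rightarrow> B_vertex set set" where
  "B_edges m n =
     {{E i, E (Suc i)} | i. i < m} \<union>
     (if 2 \<le> n then {{E 0, F 2}} else {}) \<union>
     {{F j, F (Suc j)} | j. 2 \<le> j \<and> j < n} \<union>
     (if 2 \<le> n then {{F 1, F 2}} else {})"

definition B_tree :: "nat \<Rightarrow> nat \<Rightarrow> B_vertex weighted_graph" where
  "B_tree m n =
     \<lparr>vertices = E ` {0..m} \<union> F ` {1..n},
      edges = B_edges m n,
      weight = (\<lambda>v. if v = E 0 then 3 else 2)\<rparr>"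

end

theory Submission
  imports Defs
begin

text \<open>
  For \<open>Y = \<Sum> a\<^sub>i E\<^sub>i + \<Sum> f\<^sub>j F\<^sub>j\<close>, with \<open>a\<^sub>i\<close>, \<open>f\<^sub>j\<close> set to zero outside the index range, put
  \<open>d\<^sub>i = a\<^sub>i - a\<^sub>i\<^sub>+\<^sub>1\<close> for \<open>0 \<le> i \<le> m\<close> and \<open>x\<^sub>j = f\<^sub>j\<^sub>+\<^sub>1 - f\<^sub>j - [j \<le> 1] a\<^sub>0\<close> for \<open>0 \<le> j \<le> n\<close>.
  Completing squares gives \<open>- (Y \<cdot> Y) = \<Sum> d\<^sub>i\<^sup>2 + \<Sum> x\<^sub>j\<^sup>2\<close>, so the divisors form the sublattice
  \<open>2 \<Sum> d\<^sub>i + \<Sum> x\<^sub>j = 0\<close> of the standard lattice of rank \<open>m + n + 2\<close>. In the standard basis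
  \<open>e\<^sub>i\<close>, \<open>\<epsilon>\<^sub>j\<close> its vectors of norm 2 are \<open>e\<^sub>i - e\<^sub>j\<close> and \<open>\<epsilon>\<^sub>i - \<epsilon>\<^sub>j\<close>, those of norm 3 are
  \<open>\<plusminus>(e\<^sub>k - \<epsilon>\<^sub>i - \<epsilon>\<^sub>j)\<close>, always with \<open>i \<noteq> j\<close>, and each of them has coefficients of constant sign.
\<close>

section \<open>Coordinates diagonalising the form, and their inverse\<close>

fun coords :: "(B_vertex \<Rightarrow>\<^sub>0 int) \<Rightarrow> B_vertex \<Rightarrow> int" where
  "coords Y (E i) = Poly_Mapping.lookup Y (E i) - Poly_Mapping.lookup Y (E (Suc i))"
| "coords Y (F j) = Poly_Mapping.lookup Y (F (Suc j)) - Poly_Mapping.lookup Y (F j)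
     - of_bool (j \<le> 1) * Poly_Mapping.lookup Y (E 0)"

text \<open>Inverse of \<open>coords\<close> on divisors, by telescoping down from the top index;
  the inner sum over \<open>k\<close> recovers the coefficient of \<open>E 0\<close>.\<close>

fun coeffs_of_coords :: "nat \<Rightarrow> nat \<Rightarrow> (B_vertex \<Rightarrow> int) \<Rightarrow> B_vertex \<Rightarrow> int" where
  "coeffs_of_coords m n v (E i) = (\<Sum>k=i..m. v (E k))"
| "coeffs_of_coords m n v (F j) = - (\<Sum>l=j..n. v (F l) + of_bool (l \<le> 1) * (\<Sum>k=0..m. v (E k)))"

text \<open>The \<open>F\<close> indices start at 0 although \<open>F 0\<close> is not a vertex:
  there is one coordinate more than there are vertices, balanced by the one linear equation of
  \<open>coord_lattice\<close>.\<close>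

definition coord_index :: "nat \<Rightarrow> nat \<Rightarrow> B_vertex set" where
  "coord_index m n = E ` {0..m} \<union> F ` {0..n}"

fun coord_weight :: "B_vertex \<Rightarrow> int" where
  "coord_weight (E i) = 2"
| "coord_weight (F j) = 1"

definition coord_lattice :: "nat \<Rightarrow> nat \<Rightarrow> (B_vertex \<Rightarrow> int) set" where
  "coord_lattice m n = {v. (\<forall>p. p \<notin> coord_index m n \<longrightarrow> v p = 0) \<and>
     (\<Sum>p\<in>coord_index m n. coord_weight p * v p) = 0}"

definition coord_norm :: "nat \<Rightarrow> nat \<Rightarrow> (B_vertex \<Rightarrow> int) \<Rightarrow> int" where
  "coord_norm m n v = (\<Sum>p\<in>coord_index m n. (v p)\<^sup>2)"

lemma finite_coord_index: "finite (coord_index m n)"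
  by (simp add: coord_index_def)

lemma coord_index_iff [simp]:
  "E i \<in> coord_index m n \<longleftrightarrow> i \<le> m" "F j \<in> coord_index m n \<longleftrightarrow> j \<le> n"
  by (auto simp: coord_index_def)

lemma sum_coord_index:
  "sum g (coord_index m n) = (\<Sum>i=0..m. g (E i)) + (\<Sum>j=0..n. (g (F j) :: int))"
proof -
  have "sum g (coord_index m n) = sum g (E ` {0..m}) + sum g (F ` {0..n})"
    unfolding coord_index_def by (rule sum.union_disjoint) auto
  then show ?thesis
    by (simp add: sum.reindex inj_on_def)
qed

lemma sum_diff_Suc_vanishing:
  fixes f :: "nat \<Rightarrow> int"
  assumes "\<And>i. m < i \<Longrightarrow> f i = 0"
  shows "(\<Sum>k=i..m. f k - f (Suc k)) = f i"
proof (cases "i \<le> m")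
  case True
  then have "(\<Sum>k=i..m. f (Suc k) - f k) = f (Suc m) - f i"
    by (intro sum_Suc_diff) simp
  then show ?thesis
    using assms[of "Suc m"] by (simp add: sum_subtractf)
next
  case False
  then show ?thesis using assms[of i] by simp
qed

lemma sum_of_bool_le_1:
  fixes g :: "nat \<Rightarrow> int"
  assumes "n \<ge> 1"
  shows "(\<Sum>l=0..n. of_bool (l \<le> 1) * g l) = g 0 + g 1"
proof -
  have "(\<Sum>l=0..n. of_bool (l \<le> 1) * g l) = (\<Sum>l\<in>{0,1}. of_bool (l \<le> 1) * g l)"
    using assms by (intro sum.mono_neutral_right) auto
  then show ?thesis by simp
qed

section \<open>Divisors as vectors of the coordinate lattice\<close>

lemma divisors_B_tree_iff:
  "Y \<in> divisors (B_tree m n) \<longleftrightarrow>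
     (\<forall>i>m. Poly_Mapping.lookup Y (E i) = 0) \<and>
     (\<forall>j. j = 0 \<or> n < j \<longrightarrow> Poly_Mapping.lookup Y (F j) = 0)" (is "?L = ?R")
proof
  assume ?L
  then have zero: "Poly_Mapping.lookup Y v = 0" if "v \<notin> E ` {0..m} \<union> F ` {1..n}" for v
    using that by (auto simp: divisors_def B_tree_def in_keys_iff)
  show ?R by (auto intro!: zero)
next
  assume R: ?R
  have "v \<in> E ` {0..m} \<union> F ` {1..n}" if "Poly_Mapping.lookup Y v \<noteq> 0" for v
    using R that by (cases v) (force simp: not_less Suc_le_eq)+
  then show ?L
    by (auto simp: divisors_def B_tree_def in_keys_iff)
qed

lemma coeffs_of_coords_coords:
  assumes "Y \<in> divisors (B_tree m n)"
  shows "coeffs_of_coords m n (coords Y) = Poly_Mapping.lookup Y"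
proof
  let ?a = "\<lambda>i. Poly_Mapping.lookup Y (E i)" and ?f = "\<lambda>j. Poly_Mapping.lookup Y (F j)"
  have E: "(\<Sum>k=i..m. ?a k - ?a (Suc k)) = ?a i" for i
    using assms by (intro sum_diff_Suc_vanishing) (simp add: divisors_B_tree_iff)
  have F: "(\<Sum>k=j..n. ?f k - ?f (Suc k)) = ?f j" for j
    using assms by (intro sum_diff_Suc_vanishing) (simp add: divisors_B_tree_iff)
  show "coeffs_of_coords m n (coords Y) v = Poly_Mapping.lookup Y v" for v
  proof (cases v)
    case (E i)
    then show ?thesis using \<open>\<And>i. (\<Sum>k=i..m. ?a k - ?a (Suc k)) = ?a i\<close> by simp
  next
    case (F j)
    then show ?thesis
      using \<open>\<And>j. (\<Sum>k=j..n. ?f k - ?f (Suc k)) = ?f j\<close>[of j] E[of 0]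
      by (simp add: sum_subtractf)
  qed
qed

text \<open>Since \<open>n \<ge> 1\<close>, the tail sum from \<open>F 0\<close> contains both
  \<open>l = 0\<close> and \<open>l = 1\<close>, so the total of the \<open>E\<close> coordinates is
  counted twice. This is the weight 2 in \<open>coord_weight\<close>.\<close>

lemma weighted_sum_coords:
  assumes "n \<ge> 1"
  shows "(\<Sum>p\<in>coord_index m n. coord_weight p * v p) = - coeffs_of_coords m n v (F 0)"
  by (simp only: sum_coord_index coeffs_of_coords.simps coord_weight.simps sum.distrib
      sum_of_bool_le_1[OF assms] sum_distrib_left[symmetric])

text \<open>The lattice equation says that telescoping down to \<open>F 0\<close> ends in 0, and
  this value is the coefficient at a non-vertex.\<close>

lemma coords_in_lattice:
  assumes "n \<ge> 1" "Y \<in> divisors (B_tree m n)"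
  shows "coords Y \<in> coord_lattice m n"
proof -
  have "coords Y p = 0" if "p \<notin> coord_index m n" for p
    using that assms by (cases p) (auto simp: divisors_B_tree_iff)
  moreover have "coeffs_of_coords m n (coords Y) (F 0) = 0"
    using assms(2) by (simp only: coeffs_of_coords_coords) (simp add: divisors_B_tree_iff)
  then have "(\<Sum>p\<in>coord_index m n. coord_weight p * coords Y p) = 0"
    using assms(1) by (simp only: weighted_sum_coords minus_zero)
  ultimately show ?thesis by (simp add: coord_lattice_def)
qed

text \<open>The preimage has coefficients \<open>coeffs_of_coords m n v\<close>: empty sums vanish
  above the index range and the lattice equation gives 0 at \<open>F 0\<close>, so the support
  consists of vertices.\<close>

lemma coords_surj:
  assumes "n \<ge> 1" "v \<in> coord_lattice m n"
  obtains Y where "Y \<in> divisors (B_tree m n)" "coords Y = v"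
proof -
  let ?c = "coeffs_of_coords m n v"
  have "(\<Sum>p\<in>coord_index m n. coord_weight p * v p) = 0"
    using assms(2) by (simp add: coord_lattice_def)
  then have F0: "?c (F 0) = 0"
    using assms(1) by (simp only: weighted_sum_coords neg_equal_0_iff_equal)
  have "?c p = 0" if "p \<notin> coord_index m n" for p
    using that by (cases p) auto
  then have "{p. ?c p \<noteq> 0} \<subseteq> coord_index m n" by blast
  then have fin: "finite {p. ?c p \<noteq> 0}"
    using finite_coord_index finite_subset by blast
  define Y where "Y = Abs_poly_mapping ?c"
  have Y: "Poly_Mapping.lookup Y = ?c"
    unfolding Y_def using fin by simp
  have zero: "v (E i) = 0" if "m < i" for i
    using assms(2) that by (auto simp: coord_lattice_def)
  have zero': "v (F i) = 0" if "n < i" for i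
    using assms(2) that by (auto simp: coord_lattice_def)
  show thesis
  proof
    show "Y \<in> divisors (B_tree m n)"
      unfolding divisors_B_tree_iff Y using F0 by auto
    show "coords Y = v"
    proof
      \<comment> \<open>Consecutive tail sums differ by one summand; beyond the range both are empty
        and \<open>v\<close> vanishes too.\<close>
      show "coords Y p = v p" for p
      proof (cases p)
        case (E i)
        then show ?thesis
          using zero[of i] by (cases "i \<le> m") (auto simp: Y sum.atLeast_Suc_atMost[of i])
      next
        case (F j)
        then show ?thesis
          using zero'[of j] \<open>n \<ge> 1\<close> by (cases "j \<le> n") (auto simp: Y sum.atLeast_Suc_atMost[of j])
      qed
    qed
  qed
qed

section \<open>The intersection form as a negative sum of squares\<close>

text \<open>Completing squares for a chain of weight 2: each vertex enters one difference per
  neighbour, and the two end squares stand in for the missing neighbours. A new vertex adds one row,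
  one column and one diagonal entry.\<close>

lemma sum_chain_form:
  fixes b :: "nat \<Rightarrow> int"
  shows "(\<Sum>i=0..m. \<Sum>j=0..m. b i * b j *
      (if i = j then - 2 else if j = Suc i \<or> i = Suc j then 1 else 0)) =
    - ((b 0)\<^sup>2 + (\<Sum>i<m. (b i - b (Suc i))\<^sup>2) + (b m)\<^sup>2)"
proof (induction m)
  case 0
  then show ?case by (simp add: power2_eq_square)
next
  case (Suc m)
  let ?h = "\<lambda>i j. b i * b j * (if i = j then - 2 else if j = Suc i \<or> i = Suc j then 1 else 0 :: int)"
  have row: "(\<Sum>j=0..m. ?h (Suc m) j) = b (Suc m) * b m"
  proof -
    have "(\<Sum>j=0..m. ?h (Suc m) j) = (\<Sum>j\<in>{m}. ?h (Suc m) j)"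
      by (intro sum.mono_neutral_right) auto
    then show ?thesis by simp
  qed
  have col: "(\<Sum>i=0..m. ?h i (Suc m)) = b (Suc m) * b m"
  proof -
    have "(\<Sum>i=0..m. ?h i (Suc m)) = (\<Sum>i\<in>{m}. ?h i (Suc m))"
      by (intro sum.mono_neutral_right) auto
    then show ?thesis by simp
  qed
  have "(\<Sum>i=0..Suc m. \<Sum>j=0..Suc m. ?h i j) =
      (\<Sum>i=0..m. \<Sum>j=0..m. ?h i j) + (\<Sum>i=0..m. ?h i (Suc m)) + (\<Sum>j=0..m. ?h (Suc m) j) + ?h (Suc m) (Suc m)"
    by (simp only: sum.atLeast0_atMost_Suc sum.distrib ac_simps)
  also have "\<dots> = - ((b 0)\<^sup>2 + (\<Sum>i<Suc m. (b i - b (Suc i))\<^sup>2) + (b (Suc m))\<^sup>2)"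
    unfolding Suc.IH row col by (simp add: power2_eq_square algebra_simps)
  finally show ?case .
qed

lemma sum_chain_form':
  fixes b :: "nat \<Rightarrow> int"
  assumes "b (Suc m) = 0"
  shows "(\<Sum>i=0..m. \<Sum>j=0..m. b i * b j *
      (if i = j then - 2 else if j = Suc i \<or> i = Suc j then 1 else 0)) =
    - ((b 0)\<^sup>2 + (\<Sum>i=0..m. (b i - b (Suc i))\<^sup>2))"
  unfolding sum_chain_form using assms by (simp add: atLeast0AtMost lessThan_Suc_atMost[symmetric])

text \<open>The \<open>E\<close> block and the \<open>F\<close> block are chains, up to the extra
  weight of \<open>E 0\<close>, and they meet only in the edge from \<open>E 0\<close> to
  \<open>F 2\<close>. The shift in \<open>coords\<close> absorbs the end square at
  \<open>E 0\<close>, the extra weight and this edge.\<close>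

lemma intersection_form_B_tree:
  assumes "n \<ge> 1" "Y \<in> divisors (B_tree m n)"
  shows "intersection_form (B_tree m n) Y Y = - coord_norm m n (coords Y)"
proof -
  define a where "a i = Poly_Mapping.lookup Y (E i)" for i
  define f where "f j = Poly_Mapping.lookup Y (F j)" for j
  let ?c = "\<lambda>i j. if i = j then - 2 else if j = Suc i \<or> i = Suc j then 1 else 0 :: int"
  let ?I = "vertex_intersection (B_tree m n)"
  let ?E = "E ` {0..m}" and ?F = "F ` {1..n}"
  let ?t = "\<lambda>u v. Poly_Mapping.lookup Y u * Poly_Mapping.lookup Y v * ?I u v"
  have a_top: "a i = 0" if "m < i" for i
    using assms(2) that by (simp add: a_def divisors_B_tree_iff)
  have f_top: "f j = 0" if "n < j" for j
    using assms(2) that by (simp add: f_def divisors_B_tree_iff)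
  have f_0: "f 0 = 0"
    using assms(2) by (simp add: f_def divisors_B_tree_iff)
  have EE: "?I (E i) (E j) = ?c i j - of_bool (i = 0 \<and> j = 0)" if "i \<le> m" "j \<le> m" for i j
    using that by (auto simp: vertex_intersection_def B_tree_def B_edges_def doubleton_eq_iff)
  have FF: "?I (F i) (F j) = ?c i j" if "i \<in> {1..n}" "j \<in> {1..n}" for i j
    using that by (auto simp: vertex_intersection_def B_tree_def B_edges_def doubleton_eq_iff
        numeral_2_eq_2 le_Suc_eq)
  have EF: "?I (E i) (F j) = of_bool (i = 0 \<and> j = 2)" "?I (F j) (E i) = of_bool (i = 0 \<and> j = 2)"
    if "i \<le> m" "j \<in> {1..n}" for i j
    using that by (auto simp: vertex_intersection_def B_tree_def B_edges_def doubleton_eq_iff)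
  have split: "(\<Sum>u\<in>?E \<union> ?F. g u) = (\<Sum>i=0..m. g (E i)) + (\<Sum>j=1..n. g (F j))" for g :: "B_vertex \<Rightarrow> int"
  proof -
    have "sum g (?E \<union> ?F) = sum g ?E + sum g ?F"
      by (rule sum.union_disjoint) auto
    then show ?thesis
      by (simp add: sum.reindex inj_on_def)
  qed
  have sEE: "(\<Sum>i=0..m. \<Sum>j=0..m. ?t (E i) (E j)) = - (2 * (a 0)\<^sup>2 + (\<Sum>i=0..m. (a i - a (Suc i))\<^sup>2))"
  proof -
    have "(\<Sum>i=0..m. \<Sum>j=0..m. ?t (E i) (E j)) =
        (\<Sum>i=0..m. \<Sum>j=0..m. a i * a j * ?c i j) - (\<Sum>i=0..m. \<Sum>j=0..m. a i * a j * of_bool (i = 0 \<and> j = 0))"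
      unfolding sum_subtractf[symmetric]
      by (intro sum.cong refl) (simp add: EE a_def algebra_simps)
    moreover have "(\<Sum>i=0..m. \<Sum>j=0..m. a i * a j * of_bool (i = 0 \<and> j = 0)) = (a 0)\<^sup>2"
      by (simp add: sum.atLeast_Suc_atMost[of 0] power2_eq_square)
    ultimately show ?thesis
      using a_top by (simp add: sum_chain_form')
  qed
  have sFF: "(\<Sum>i=1..n. \<Sum>j=1..n. ?t (F i) (F j)) = - (\<Sum>j=0..n. (f j - f (Suc j))\<^sup>2)"
  proof -
    have "(\<Sum>i=1..n. \<Sum>j=1..n. ?t (F i) (F j)) = (\<Sum>i=1..n. \<Sum>j=1..n. f i * f j * ?c i j)"
      by (intro sum.cong refl) (simp add: FF f_def)
    \<comment> \<open>Adding index 0 with \<open>f 0 = 0\<close> changes nothing, kills the end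
      square and lets the differences run over \<open>0..n\<close> like the coordinates.\<close>
    also have "\<dots> = (\<Sum>i=0..n. \<Sum>j=0..n. f i * f j * ?c i j)"
      using f_0 by (simp add: sum.atLeast_Suc_atMost[of 0])
    finally show ?thesis
      using f_top f_0 by (simp add: sum_chain_form')
  qed
  have sEF: "(\<Sum>i=0..m. \<Sum>j=1..n. ?t (E i) (F j)) = a 0 * f 2"
  proof -
    have "(\<Sum>i=0..m. \<Sum>j=1..n. ?t (E i) (F j)) = (\<Sum>i=0..m. \<Sum>j=1..n. a i * f j * of_bool (i = 0 \<and> j = 2))"
      by (intro sum.cong refl) (simp add: EF a_def f_def)
    also have "\<dots> = (\<Sum>j=1..n. if j = 2 then a 0 * f j else 0)"
      by (simp add: sum.atLeast_Suc_atMost[of 0] of_bool_def if_distrib cong: if_cong)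
    \<comment> \<open>For \<open>n = 1\<close> the index 2 is out of range, but then
      \<open>f 2 = 0\<close>.\<close>
    also have "\<dots> = a 0 * f 2"
      using f_top[of 2] by (simp add: sum.delta)
    finally show ?thesis .
  qed
  have sFE: "(\<Sum>j=1..n. \<Sum>i=0..m. ?t (F j) (E i)) = a 0 * f 2"
    unfolding sEF[symmetric] by (subst sum.swap, intro sum.cong refl) (simp add: EF)
  \<comment> \<open>The shifts at \<open>j = 0\<close> and \<open>j = 1\<close> give cross terms
    telescoping to \<open>2 * a 0 * (f 0 - f 2)\<close> and two copies of
    \<open>(a 0)\<^sup>2\<close>.\<close>
  have shift: "(\<Sum>j=0..n. (coords Y (F j))\<^sup>2) = (\<Sum>j=0..n. (f j - f (Suc j))\<^sup>2) - 2 * a 0 * f 2 + 2 * (a 0)\<^sup>2"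
  proof -
    let ?g = "\<lambda>j. of_bool (j \<le> 1) * (2 * a 0 * (f j - f (Suc j)) + (a 0)\<^sup>2)"
    have "(\<Sum>j=0..n. (coords Y (F j))\<^sup>2) = (\<Sum>j=0..n. (f j - f (Suc j))\<^sup>2 + ?g j)"
      by (intro sum.cong refl) (auto simp: f_def a_def power2_eq_square algebra_simps)
    also have "\<dots> = (\<Sum>j=0..n. (f j - f (Suc j))\<^sup>2) + sum ?g {0..n}"
      by (rule sum.distrib)
    also have "sum ?g {0..n} = - 2 * a 0 * f 2 + 2 * (a 0)\<^sup>2"
      using f_0 by (subst sum_of_bool_le_1[OF \<open>n \<ge> 1\<close>]) (simp add: numeral_2_eq_2 algebra_simps)
    finally show ?thesis by simp
  qed
  have "intersection_form (B_tree m n) Y Y = (\<Sum>u\<in>?E \<union> ?F. \<Sum>v\<in>?E \<union> ?F. ?t u v)"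
    by (simp add: intersection_form_def B_tree_def)
  also have "\<dots> = (\<Sum>i=0..m. \<Sum>j=0..m. ?t (E i) (E j)) + (\<Sum>i=0..m. \<Sum>j=1..n. ?t (E i) (F j)) +
      ((\<Sum>j=1..n. \<Sum>i=0..m. ?t (F j) (E i)) + (\<Sum>i=1..n. \<Sum>j=1..n. ?t (F i) (F j)))"
    unfolding split sum.distrib by simp
  also have "\<dots> = - ((\<Sum>i=0..m. (coords Y (E i))\<^sup>2) + (\<Sum>j=0..n. (coords Y (F j))\<^sup>2))"
    unfolding sEE sEF sFE sFF shift by (simp add: a_def)
  finally show ?thesis
    by (simp add: coord_norm_def sum_coord_index)
qed

section \<open>The vectors of norm 2 and 3 and their number\<close>

text \<open>In use \<open>c\<close> is the constructor \<open>E\<close> or \<open>F\<close>, so the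
  roots of type \<open>A_m\<close> and those of type \<open>A_n\<close> share one
  definition.\<close>

definition diff_vec :: "(nat \<Rightarrow> B_vertex) \<Rightarrow> nat \<times> nat \<Rightarrow> B_vertex \<Rightarrow> int" where
  "diff_vec c = (\<lambda>(i, j) p. of_bool (p = c i) - of_bool (p = c j))"

text \<open>The order of the pair \<open>(i, j)\<close> encodes the sign, so that ordered pairs enumerate both signs.\<close>

definition triple_vec :: "nat \<times> nat \<times> nat \<Rightarrow> B_vertex \<Rightarrow> int" where
  "triple_vec = (\<lambda>(k, i, j) p. (if i < j then 1 else - 1) *
     (of_bool (p = E k) - of_bool (p = F i) - of_bool (p = F j)))"

definition off_diagonal :: "nat \<Rightarrow> (nat \<times> nat) set" where
  "off_diagonal n = (SIGMA i:{0..n}. {0..n} - {i})"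

definition short_vecs :: "nat \<Rightarrow> nat \<Rightarrow> (B_vertex \<Rightarrow> int) set" where
  "short_vecs m n = diff_vec E ` off_diagonal m \<union> diff_vec F ` off_diagonal n \<union>
     triple_vec ` ({0..m} \<times> off_diagonal n)"

lemma off_diagonal_iff [simp]: "(i, j) \<in> off_diagonal n \<longleftrightarrow> i \<le> n \<and> j \<le> n \<and> i \<noteq> j"
  by (auto simp: off_diagonal_def)

lemma short_vecs_cases:
  assumes "v \<in> short_vecs m n"
  obtains i j where "v = diff_vec E (i, j)" "i \<le> m" "j \<le> m" "i \<noteq> j"
  | i j where "v = diff_vec F (i, j)" "i \<le> n" "j \<le> n" "i \<noteq> j"
  | k i j where "v = triple_vec (k, i, j)" "k \<le> m" "i \<le> n" "j \<le> n" "i \<noteq> j"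
  using assms unfolding short_vecs_def by fastforce

lemma card_off_diagonal: "card (off_diagonal n) = n * (n + 1)" "finite (off_diagonal n)"
  by (auto simp: off_diagonal_def card_SigmaI)

lemma inj_diff_vec:
  assumes "inj c"
  shows "inj_on (diff_vec c) (off_diagonal n)"
proof (rule inj_onI, clarify)
  fix i j i' j'
  assume ij: "(i, j) \<in> off_diagonal n" "(i', j') \<in> off_diagonal n"
  assume eq: "diff_vec c (i, j) = diff_vec c (i', j')"
  show "i = i' \<and> j = j'"
    using ij fun_cong[OF eq, of "c i"] fun_cong[OF eq, of "c j"] assms
    by (auto simp: diff_vec_def inj_eq of_bool_def split: if_splits)
qed

text \<open>The support gives \<open>k\<close> and the unordered pair; the sign of the value at
  \<open>E k\<close> tells whether \<open>i < j\<close> and so orders the pair.\<close>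

lemma inj_triple_vec: "inj_on triple_vec (A \<times> off_diagonal n)"
proof (rule inj_onI)
  fix x y
  assume "x \<in> A \<times> off_diagonal n" "y \<in> A \<times> off_diagonal n" and eq: "triple_vec x = triple_vec y"
  then obtain k i j k' i' j' where xy: "x = (k, i, j)" "y = (k', i', j')" "i \<noteq> j" "i' \<noteq> j'"
    by auto
  show "x = y"
    using xy(3,4) fun_cong[OF eq, of "E k"] fun_cong[OF eq, of "F i"] fun_cong[OF eq, of "F j"]
    unfolding xy(1,2) by (auto simp: triple_vec_def of_bool_def split: if_splits)
qed

text \<open>The three families differ in support: only \<open>E\<close>, only \<open>F\<close>, or
  both kinds. Each counts ordered pairs of distinct indices, the last with \<open>m + 1\<close>
  choices of \<open>k\<close>.\<close>

lemma card_short_vecs: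
  "card (short_vecs m n) = n * (n + 1) * (m + 1) + m * (m + 1) + n * (n + 1)"
proof -
  have EF: "diff_vec E ` off_diagonal m \<inter> diff_vec F ` off_diagonal n = {}"
  proof (rule equals0I)
    fix v assume "v \<in> diff_vec E ` off_diagonal m \<inter> diff_vec F ` off_diagonal n"
    then obtain p q where pq: "p \<in> off_diagonal m" "v = diff_vec E p" "v = diff_vec F q" by blast
    obtain i j where p: "p = (i, j)" "i \<noteq> j" using pq(1) by (cases p) auto
    have "v (E i) = 1" unfolding pq(2) using p by (simp add: diff_vec_def)
    moreover have "v (E i) = 0" unfolding pq(3) by (cases q) (simp add: diff_vec_def)
    ultimately show False by simp
  qed
  have T: "(diff_vec E ` off_diagonal m \<union> diff_vec F ` off_diagonal n) \<inter>
      triple_vec ` ({0..m} \<times> off_diagonal n) = {}"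
  proof (rule equals0I)
    fix v assume v: "v \<in> (diff_vec E ` off_diagonal m \<union> diff_vec F ` off_diagonal n) \<inter>
        triple_vec ` ({0..m} \<times> off_diagonal n)"
    then have "v \<in> triple_vec ` ({0..m} \<times> off_diagonal n)" by blast
    then obtain k i j where t: "v = triple_vec (k, i, j)" "i \<noteq> j"
      by auto
    have "v (E k) \<noteq> 0" "v (F i) \<noteq> 0"
      unfolding t(1) using t(2) by (simp_all add: triple_vec_def)
    moreover have "v (E k) = 0 \<or> v (F i) = 0"
    proof -
      obtain p where "v = diff_vec E p \<or> v = diff_vec F p" using v by blast
      then show ?thesis by (cases p) (auto simp: diff_vec_def)
    qed
    ultimately show False by simp
  qed
  have "card (short_vecs m n) = card (diff_vec E ` off_diagonal m) +
      card (diff_vec F ` off_diagonal n) + card (triple_vec ` ({0..m} \<times> off_diagonal n))"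
    unfolding short_vecs_def using EF T
    by (subst card_Un_disjoint, simp_all add: card_off_diagonal, subst card_Un_disjoint)
      (simp_all add: card_off_diagonal)
  then show ?thesis
    by (simp add: card_image inj_diff_vec inj_triple_vec inj_def card_off_diagonal card_cartesian_product
        algebra_simps)
qed

section \<open>Norm and sign of the listed vectors\<close>

lemma sum_support:
  assumes "finite A" "S \<subseteq> A" "\<And>p. p \<notin> S \<Longrightarrow> g p = (0::int)"
  shows "sum g A = sum g S"
  using assms by (intro sum.mono_neutral_right) auto

text \<open>All sums collapse to the support, where the values are \<plusminus>1. Equal weights
  cancel in a difference, and \<open>2 - 1 - 1 = 0\<close> settles the mixed vectors.\<close>

lemma short_vecs_norm:
  assumes "v \<in> short_vecs m n"
  shows "v \<in> coord_lattice m n" "coord_norm m n v \<in> {2, 3}"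
proof -
  have D: "diff_vec c (i, j) \<in> coord_lattice m n \<and> coord_norm m n (diff_vec c (i, j)) = 2"
    if "c i \<in> coord_index m n" "c j \<in> coord_index m n" "c i \<noteq> c j"
      "coord_weight (c i) = coord_weight (c j)" for c i j
  proof -
    have s: "sum g (coord_index m n) = sum g {c i, c j}"
      if "\<And>p. p \<notin> {c i, c j} \<Longrightarrow> g p = 0" for g :: "_ \<Rightarrow> int"
      using that \<open>c i \<in> _\<close> \<open>c j \<in> _\<close> by (intro sum_support finite_coord_index) auto
    have "(\<Sum>p\<in>coord_index m n. coord_weight p * diff_vec c (i, j) p) = 0"
      using that by (subst s) (auto simp: diff_vec_def)
    moreover have "(\<Sum>p\<in>coord_index m n. (diff_vec c (i, j) p)\<^sup>2) = 2"
      using that by (subst s) (auto simp: diff_vec_def)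
    moreover have "diff_vec c (i, j) p = 0" if "p \<notin> coord_index m n" for p
      using that \<open>c i \<in> _\<close> \<open>c j \<in> _\<close> by (auto simp: diff_vec_def)
    ultimately show ?thesis
      by (simp add: coord_lattice_def coord_norm_def)
  qed
  have T: "triple_vec (k, i, j) \<in> coord_lattice m n \<and> coord_norm m n (triple_vec (k, i, j)) = 3"
    if "k \<le> m" "i \<le> n" "j \<le> n" "i \<noteq> j" for k i j
  proof -
    have s: "sum g (coord_index m n) = sum g {E k, F i, F j}"
      if "\<And>p. p \<notin> {E k, F i, F j} \<Longrightarrow> g p = 0" for g :: "_ \<Rightarrow> int"
      using that \<open>k \<le> m\<close> \<open>i \<le> n\<close> \<open>j \<le> n\<close> by (intro sum_support finite_coord_index) auto
    have "(\<Sum>p\<in>coord_index m n. coord_weight p * triple_vec (k, i, j) p) = 0"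
      using that by (subst s) (auto simp: triple_vec_def)
    moreover have "(\<Sum>p\<in>coord_index m n. (triple_vec (k, i, j) p)\<^sup>2) = 3"
      using that by (subst s) (auto simp: triple_vec_def)
    moreover have "triple_vec (k, i, j) p = 0" if "p \<notin> coord_index m n" for p
      using that \<open>k \<le> m\<close> \<open>i \<le> n\<close> \<open>j \<le> n\<close> by (auto simp: triple_vec_def)
    ultimately show ?thesis
      by (simp add: coord_lattice_def coord_norm_def)
  qed
  have "v \<in> coord_lattice m n \<and> coord_norm m n v \<in> {2, 3}"
    using assms by (cases rule: short_vecs_cases) (simp_all add: D T)
  then show "v \<in> coord_lattice m n" "coord_norm m n v \<in> {2, 3}" by blast+
qed

text \<open>Tail sums turn a unit vector into the indicator of an initial segment. Two such segments
  are nested, so their difference has constant sign; mixed vectors also require a comparison with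
  the shift by the coefficient of \<open>E 0\<close>.\<close>

lemma short_vecs_sign:
  assumes "n \<ge> 1" "v \<in> short_vecs m n"
  shows "(\<forall>p. coeffs_of_coords m n v p \<ge> 0) \<or> (\<forall>p. coeffs_of_coords m n v p \<le> 0)"
proof -
  have delta: "(\<Sum>k=i..m. of_bool (k = p)) = (of_bool (i \<le> p \<and> p \<le> m) :: int)" for i m p :: nat
    by (simp add: of_bool_def)
  have E: "(\<forall>p. coeffs_of_coords m n (diff_vec E (i, j)) p \<ge> 0) \<or>
      (\<forall>p. coeffs_of_coords m n (diff_vec E (i, j)) p \<le> 0)" if "i \<le> m" "j \<le> m" for i j
  proof -
    have "coeffs_of_coords m n (diff_vec E (i, j)) (E p) = of_bool (p \<le> i) - of_bool (p \<le> j)"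
      "coeffs_of_coords m n (diff_vec E (i, j)) (F p) = 0" for p
      using that by (simp_all add: diff_vec_def sum_subtractf delta)
    then have "coeffs_of_coords m n (diff_vec E (i, j)) p =
        (case p of E p \<Rightarrow> of_bool (p \<le> i) - of_bool (p \<le> j) | F p \<Rightarrow> 0)" for p
      by (cases p) (simp_all del: coeffs_of_coords.simps)
    then show ?thesis
      by (cases "i \<le> j") (auto split: B_vertex.split)
  qed
  have F: "(\<forall>p. coeffs_of_coords m n (diff_vec F (i, j)) p \<ge> 0) \<or>
      (\<forall>p. coeffs_of_coords m n (diff_vec F (i, j)) p \<le> 0)" if "i \<le> n" "j \<le> n" for i j
  proof -
    have "coeffs_of_coords m n (diff_vec F (i, j)) (F p) = of_bool (p \<le> j) - of_bool (p \<le> i)"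
      "coeffs_of_coords m n (diff_vec F (i, j)) (E p) = 0" for p
      using that by (simp_all add: diff_vec_def sum_subtractf delta)
    then have "coeffs_of_coords m n (diff_vec F (i, j)) p =
        (case p of F p \<Rightarrow> of_bool (p \<le> j) - of_bool (p \<le> i) | E p \<Rightarrow> 0)" for p
      by (cases p) (simp_all del: coeffs_of_coords.simps)
    then show ?thesis
      by (cases "i \<le> j") (auto split: B_vertex.split)
  qed
  have T: "(\<forall>p. coeffs_of_coords m n (triple_vec (k, i, j)) p \<ge> 0) \<or>
      (\<forall>p. coeffs_of_coords m n (triple_vec (k, i, j)) p \<le> 0)"
    if "k \<le> m" "i \<le> n" "j \<le> n" "i \<noteq> j" for k i j
  proof -
    define s :: int where "s = (if i < j then 1 else - 1)"
    let ?g = "\<lambda>p. of_bool (p \<le> i) + of_bool (p \<le> j) - (of_bool (p \<le> 0) + of_bool (p \<le> 1)) :: int"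
    have vec: "triple_vec (k, i, j) (E p) = s * of_bool (p = k)"
      "triple_vec (k, i, j) (F p) = s * (- of_bool (p = i) - of_bool (p = j))" for p
      by (simp_all add: triple_vec_def s_def)
    have le1: "(\<Sum>l=p..n. of_bool (l \<le> 1)) = (of_bool (p \<le> 0) + of_bool (p \<le> 1) :: int)" for p
    proof -
      have "(\<Sum>l=p..n. of_bool (l \<le> 1)) = (\<Sum>l=p..n. of_bool (l = 0) + of_bool (l = 1) :: int)"
        by (intro sum.cong) auto
      also have "\<dots> = of_bool (p \<le> 0) + of_bool (p \<le> 1)"
        using \<open>n \<ge> 1\<close> by (simp only: sum.distrib delta) simp
      finally show ?thesis .
    qed
    have coeff_E: "coeffs_of_coords m n (triple_vec (k, i, j)) (E p) = s * of_bool (p \<le> k)" for p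
      using that by (simp only: coeffs_of_coords.simps vec sum_distrib_left[symmetric] delta) simp
    have coeff_F: "coeffs_of_coords m n (triple_vec (k, i, j)) (F p) = s * ?g p" for p
    proof -
      have "coeffs_of_coords m n (triple_vec (k, i, j)) (F p) =
          (\<Sum>l=p..n. s * (of_bool (l = i) + of_bool (l = j) - of_bool (l \<le> 1)))"
        using coeff_E[of 0]
        by (simp only: coeffs_of_coords.simps vec sum_negf[symmetric]) (simp add: algebra_simps)
      also have "\<dots> = s * ?g p"
        using that by (simp only: sum_distrib_left[symmetric] sum_subtractf sum.distrib delta le1) simp
      finally show ?thesis .
    qed
    have *: "coeffs_of_coords m n (triple_vec (k, i, j)) p =
        s * (case p of E p \<Rightarrow> of_bool (p \<le> k) | F p \<Rightarrow> ?g p)" for p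
      by (cases p) (simp_all only: coeff_E coeff_F B_vertex.case)
    \<comment> \<open>Of two distinct naturals the smaller is at least 0 and the larger at least 1,
      so the segments up to \<open>i\<close> and \<open>j\<close> cover those up to 0 and 1.\<close>
    have "?g p \<ge> 0" for p
      using \<open>i \<noteq> j\<close> by (cases "p = 0"; cases "p = 1") auto
    then have "(case p of E p \<Rightarrow> of_bool (p \<le> k) | F p \<Rightarrow> ?g p) \<ge> 0" for p
      by (cases p) simp_all
    then show ?thesis unfolding * by (simp add: s_def)
  qed
  show ?thesis
    using assms(2)
  proof (cases rule: short_vecs_cases)
    case (3 k i j)
    show ?thesis unfolding 3(1) by (rule T[OF 3(2-5)])
  qed (simp_all only: E F)
qed

section \<open>Completeness of the list\<close>

text \<open>A norm below 4 leaves only the values 0 and \<plusminus>1, so the norm is the size of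
  the support. The weights 2 and 1 in the lattice equation then decide which supports and signs
  occur.\<close>

lemma short_vecs_complete:
  assumes "v \<in> coord_lattice m n" "coord_norm m n v \<in> {2, 3}"
  shows "v \<in> short_vecs m n"
proof -
  define S where "S = {p \<in> coord_index m n. v p \<noteq> 0}"
  have sub: "S \<subseteq> coord_index m n"
    by (auto simp: S_def)
  have off: "v p = 0" if "p \<notin> S" for p
    using that assms(1) by (auto simp: S_def coord_lattice_def)
  have unit: "v p = 1 \<or> v p = - 1" if "p \<in> S" for p
  proof -
    have "(v p)\<^sup>2 \<le> coord_norm m n v"
      unfolding coord_norm_def using that finite_coord_index
      by (intro member_le_sum) (auto simp: S_def)
    then have "\<bar>v p\<bar>\<^sup>2 < 2\<^sup>2" using assms(2) by auto
    then have "\<bar>v p\<bar> < 2" by (rule power2_less_imp_less) simp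
    then show ?thesis using that by (auto simp: S_def)
  qed
  have "coord_norm m n v = (\<Sum>p\<in>S. (v p)\<^sup>2)"
    unfolding coord_norm_def using off by (intro sum_support finite_coord_index sub) auto
  also have "\<dots> = (\<Sum>p\<in>S. 1)"
    using unit by (intro sum.cong) (auto simp: power2_eq_1_iff)
  finally have card: "card S = 2 \<or> card S = 3"
    using assms(2) by auto
  have "(\<Sum>p\<in>coord_index m n. coord_weight p * v p) = (\<Sum>p\<in>S. coord_weight p * v p)"
    using off by (intro sum_support finite_coord_index sub) auto
  then have lin: "(\<Sum>p\<in>S. coord_weight p * v p) = 0"
    using assms(1) by (simp add: coord_lattice_def)
  have diffI: "v \<in> diff_vec c ` off_diagonal N"
    if "S = {c i, c j}" "i \<noteq> j" "inj c" "i \<le> N" "j \<le> N" "v (c i) + v (c j) = 0" for c i j N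
  proof -
    have "v = diff_vec c (i, j) \<or> v = diff_vec c (j, i)"
    proof (cases "v (c i) = 1")
      case True
      then have "v p = diff_vec c (i, j) p" for p
        using that off[of p] by (cases "p \<in> S") (auto simp: diff_vec_def inj_eq)
      then show ?thesis by blast
    next
      case False
      then have "v (c i) = - 1" using unit[of "c i"] that by simp
      then have "v p = diff_vec c (j, i) p" for p
        using that off[of p] by (cases "p \<in> S") (auto simp: diff_vec_def inj_eq)
      then show ?thesis by blast
    qed
    then show ?thesis using that by auto
  qed
  have tripleI: "v \<in> triple_vec ` ({0..m} \<times> off_diagonal n)"
    if S: "S = {E k, F i, F j}" "i \<noteq> j" and vals: "v (F i) = - v (E k)" "v (F j) = - v (E k)" for k i j
  proof -
    have le: "k \<le> m" "i \<le> n" "j \<le> n" using sub S by auto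
    have E: "v (E k) = 1 \<or> v (E k) = - 1" using unit S by auto
    \<comment> \<open>The pair is ordered so that the sign encoded in \<open>triple_vec\<close>
      equals \<open>v (E k)\<close>.\<close>
    define q where "q = (if i < j \<longleftrightarrow> v (E k) = 1 then (i, j) else (j, i))"
    have "v p = triple_vec (k, q) p" for p
      using S vals E off[of p] by (cases "p \<in> S") (auto simp: triple_vec_def q_def)
    then have "v = triple_vec (k, q)" by blast
    then show ?thesis using le \<open>i \<noteq> j\<close> by (auto simp: q_def)
  qed
  from card show ?thesis
  proof
    assume "card S = 2"
    then obtain p q where S: "S = {p, q}" "p \<noteq> q" by (auto simp: card_2_iff)
    then have "coord_weight p * v p + coord_weight q * v q = 0"
      using lin by simp
    \<comment> \<open>One \<open>E\<close> and one \<open>F\<close> would force \<plusminus>2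
      \<plusminus> 1 = 0, so both are of the same kind, with opposite values.\<close>
    then show ?thesis
      using S unit[of p] unit[of q] diffI[of E _ _ m] diffI[of F _ _ n] sub
      by (cases p; cases q) (auto simp: short_vecs_def inj_def)
  next
    assume "card S = 3"
    then obtain p q r where S: "S = {p, q, r}" "p \<noteq> q" "p \<noteq> r" "q \<noteq> r"
      by (auto simp: card_3_iff)
    then have eq: "coord_weight p * v p + coord_weight q * v q + coord_weight r * v r = 0"
      using lin by simp
    have u: "v p = 1 \<or> v p = - 1" "v q = 1 \<or> v q = - 1" "v r = 1 \<or> v r = - 1"
      using unit S by auto
    have perm: "S = {q, p, r}" "S = {r, p, q}" using S by auto
    \<comment> \<open>By parity the support contains 0 or 2 of the \<open>F\<close>, and three signs
      cannot sum to 0, which excludes three \<open>E\<close>. So one \<open>E\<close> faces two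
      \<open>F\<close> of opposite value; the cases only locate the \<open>E\<close>.\<close>
    have "v \<in> triple_vec ` ({0..m} \<times> off_diagonal n)"
    proof (cases p)
      case p: (E k)
      obtain i j where "q = F i" "r = F j" using u eq p by (cases q; cases r) auto
      then show ?thesis using tripleI[of k i j] p S u eq by auto
    next
      case p: (F i)
      consider k j where "q = E k" "r = F j" | j k where "q = F j" "r = E k"
        using u eq p by (cases q; cases r) auto
      then show ?thesis
      proof cases
        case 1
        then show ?thesis using tripleI[of k i j] p S perm u eq by auto
      next
        case 2
        then show ?thesis using tripleI[of k i j] p S perm u eq by auto
      qed
    qed
    then show ?thesis by (simp add: short_vecs_def)
  qed
qed

section \<open>Counting the roots through the coordinate bijection\<close>

theorem proposition3p16:
  fixes m n :: nat
  assumes "n \<ge> 1"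
  shows "card (triple_root_system (B_tree m n)) = n * (n + 1) * (m + 1) + m * (m + 1) + n * (n + 1)"
proof -
  have "bij_betw coords (triple_root_system (B_tree m n)) (short_vecs m n)"
    unfolding bij_betw_def
  proof
    show "inj_on coords (triple_root_system (B_tree m n))"
    proof (rule inj_onI)
      fix X Y assume "X \<in> triple_root_system (B_tree m n)" "Y \<in> triple_root_system (B_tree m n)"
        and eq: "coords X = coords Y"
      then have "X \<in> divisors (B_tree m n)" "Y \<in> divisors (B_tree m n)"
        by (auto simp: triple_root_system_def positive_divisor_def negative_divisor_def)
      then show "X = Y"
        using eq coeffs_of_coords_coords by (metis poly_mapping_eqI)
    qed
    show "coords ` triple_root_system (B_tree m n) = short_vecs m n"
    proof
      show "coords ` triple_root_system (B_tree m n) \<subseteq> short_vecs m n"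
      proof
        fix v assume "v \<in> coords ` triple_root_system (B_tree m n)"
        then obtain Y where Y: "Y \<in> triple_root_system (B_tree m n)" "v = coords Y" by blast
        then have d: "Y \<in> divisors (B_tree m n)"
          by (auto simp: triple_root_system_def positive_divisor_def negative_divisor_def)
        then have "coord_norm m n v \<in> {2, 3}"
          using Y intersection_form_B_tree[OF assms d] by (auto simp: triple_root_system_def)
        then show "v \<in> short_vecs m n"
          using short_vecs_complete coords_in_lattice[OF assms d] Y by blast
      qed
      show "short_vecs m n \<subseteq> coords ` triple_root_system (B_tree m n)"
      proof
        fix v assume v: "v \<in> short_vecs m n"
        obtain Y where Y: "Y \<in> divisors (B_tree m n)" "coords Y = v"
          using coords_surj[OF assms short_vecs_norm(1)[OF v]] by blast
        have form: "intersection_form (B_tree m n) Y Y \<in> {- 2, - 3}"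
          using intersection_form_B_tree[OF assms Y(1)] short_vecs_norm(2)[OF v] Y(2) by auto
        then have "Y \<noteq> 0" by (auto simp: intersection_form_def)
        \<comment> \<open>The coefficients of \<open>Y\<close> are those recovered from
          \<open>v\<close>, so their constant sign makes \<open>Y\<close> a positive or negative
          divisor.\<close>
        moreover have "(\<forall>p. Poly_Mapping.lookup Y p \<ge> 0) \<or> (\<forall>p. Poly_Mapping.lookup Y p \<le> 0)"
          using short_vecs_sign[OF assms v] coeffs_of_coords_coords[OF Y(1)] Y(2) by simp
        ultimately have "Y \<in> triple_root_system (B_tree m n)"
          using form Y(1) by (auto simp: triple_root_system_def positive_divisor_def negative_divisor_def)
        then show "v \<in> coords ` triple_root_system (B_tree m n)" using Y(2) by blast
      qed
    qed
  qed
  then show ?thesis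
    using bij_betw_same_card card_short_vecs by metis
qed

end
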